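(* Let $n \ge 1$. The vertices of the elliptope $\mathcal{L}_n$ are exactly the attractive fixed points of $T$; that is, a matrix $X \in \mathcal{L}_n$ is an attractive fixed point of $T$ if and only if $X$ is a vertex of $\mathcal{L}_n$.
   Context: Let $\mathcal{S}(n)$ be the space of real symmetric $n\times n$ matrices with inner product $X\cdot Y = \sum_{i,j} X_{i,j}Y_{i,j}$ and norm $\|X\| = \sqrt{X\cdot X}$. The elliptope is $\mathcal{L}_n = \{ X \in \mathcal{S}(n) : X \succeq 0,\ X_{i,i} = 1 \text{ for all } i\}$. Its vertices are the rank-one matrices in $\mathcal{L}_n$ with all entries in $\{-1,+1\}$, i.e. the matrices $vv^\top$ with $v \in \{-1,+1\}^n$. For $M \in \mathcal{S}(n)$, $T(M) = \operatorname{argmax}_{Y \in \mathcal{L}_n} M\cdot Y$ denotes the set of all maximizers. A fixed point of $T$ is a matrix $X \in \mathcal{L}_n$ with $X \in T(X)$. Iteration with $T$ starting at $X_0$ means any sequence with $X_{i+1} \in T(X_i)$ for all $i\ge 0$. A fixed point $X$ is attractive if there exists $\epsilon > 0$ such that for every $X_0 \in \mathcal{L}_n$ with $\|X - X_0\| < \epsilon$, iteration with $T$ starting at $X_0$ converges to $X$ (for every sequence obtained by such iteration). *)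

theory Defs
  imports "HOL-Analysis.Analysis"
begin

text \<open>
  Matrices of size \<open>n \<times> n\<close> are elements of \<^typ>\<open>real^'n^'n\<close> with \<open>n = CARD('n) \<ge> 1\<close>. The
  library inner product and norm on this type are the Frobenius ones.
\<close>

lemma inner_matrix_eq_sum: "X \<bullet> Y = (\<Sum>i\<in>UNIV. \<Sum>j\<in>UNIV. X$i$j * Y$i$j)"
  for X Y :: "real^'n^'n"
  by (simp add: inner_vec_def)

lemma norm_matrix_eq_sqrt: "norm X = sqrt (X \<bullet> X)"
  for X :: "real^'n^'n"
  by (rule norm_eq_sqrt_inner)

definition symmetric_matrix :: "real^'n^'n \<Rightarrow> bool"
  where "symmetric_matrix X \<longleftrightarrow> transpose X = X"

definition psd :: "real^'n^'n \<Rightarrow> bool"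
  where "psd X \<longleftrightarrow> symmetric_matrix X \<and> (\<forall>x. 0 \<le> x \<bullet> (X *v x))"

definition elliptope :: "(real^'n^'n) set"
  where "elliptope = {X. psd X \<and> (\<forall>i. X$i$i = 1)}"

definition elliptope_vertices :: "(real^'n^'n) set"
  where "elliptope_vertices = {X \<in> elliptope. rank X = 1 \<and> (\<forall>i j. X$i$j \<in> {-1, 1})}"

lemma elliptope_vertices_eq_outer_products:
  "(elliptope_vertices :: (real^'n^'n) set)
    = {(\<chi> i j. v$i * v$j) | v :: real^'n. \<forall>i. v$i \<in> {-1, 1}}"
  (is "?L = ?R")
proof (intro equalityI subsetI)
  fix X :: "real^'n^'n"
  assume X: "X \<in> ?L"
  fix k :: 'n
  have sym: "X$i$j = X$j$i" for i j
    using X by (auto simp: elliptope_vertices_def elliptope_def psd_def symmetric_matrix_def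
        transpose_def vec_eq_iff)
  have diag: "X$i$i = 1" for i
    using X by (simp add: elliptope_vertices_def elliptope_def)
  have dim: "dim (rows X) = 1"
    using X by (simp add: elliptope_vertices_def row_rank_def)
  have rows: "X$i \<in> rows X" for i
    by (auto simp: rows_def row_def)
  have nz: "X$k \<noteq> 0"
    using diag[of k] by auto
  have "rows X \<subseteq> span {X$k}"
    using card_ge_dim_independent[of "{X$k}" "rows X"] rows nz dim by simp
  then have "\<exists>c. X$i = c *\<^sub>R X$k" for i
    using rows[of i] by (auto simp: span_singleton)
  then obtain c where c: "\<And>i. X$i = c i *\<^sub>R X$k"
    by metis
  have "c i = X$i$k" for i
    using arg_cong[OF c, of "\<lambda>r. r$k" i] diag[of k] by simp
  then have prod: "X$i$j = X$i$k * X$j$k" for i j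
    using arg_cong[OF c, of "\<lambda>r. r$j" i] sym[of k j] by simp
  have "X = (\<chi> i j. (\<chi> i. X$i$k)$i * (\<chi> i. X$i$k)$j)"
    unfolding vec_eq_iff vec_lambda_beta by (intro allI prod)
  moreover have "\<forall>i. (\<chi> i. X$i$k)$i \<in> {-1, 1}"
    using X by (simp add: elliptope_vertices_def)
  ultimately show "X \<in> ?R"
    by blast
next
  fix X :: "real^'n^'n"
  assume "X \<in> ?R"
  then obtain v :: "real^'n" where X: "X = (\<chi> i j. v$i * v$j)" and v: "\<And>i. v$i \<in> {-1, 1}"
    by blast
  fix k :: 'n
  have sq: "v$i * v$i = 1" for i
    using v[of i] by auto
  have "X *v x = (v \<bullet> x) *\<^sub>R v" for x
    by (simp add: X vec_eq_iff matrix_vector_mult_def inner_vec_def sum_distrib_left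
        mult_ac)
  then have "psd X"
    by (auto simp: psd_def symmetric_matrix_def X transpose_def mult.commute inner_commute)
  then have ell: "X \<in> elliptope"
    by (simp add: elliptope_def X sq)
  have row: "row i X = v$i *\<^sub>R v" for i
    by (simp add: X row_def vec_eq_iff)
  have sub: "rows X \<subseteq> span {v}"
    by (auto simp: rows_def row span_singleton)
  have "v$k *\<^sub>R row k X \<in> span (rows X)"
    by (intro span_scale span_base) (auto simp: rows_def)
  then have "{v} \<subseteq> span (rows X)"
    by (simp add: row sq)
  with sub have "span (rows X) = span {v}"
    by (simp add: span_eq)
  then have "dim (rows X) = dim {v}"
    by (metis dim_span)
  moreover have "v \<noteq> 0"
    using sq[of k] by auto
  ultimately have "rank X = 1"
    by (simp add: row_rank_def)
  moreover have "X$i$j \<in> {-1, 1}" for i j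
    using v[of i] v[of j] by (auto simp: X)
  ultimately show "X \<in> ?L"
    using ell by (simp add: elliptope_vertices_def)
qed

definition argmax_elliptope :: "real^'n^'n \<Rightarrow> (real^'n^'n) set"
  where "argmax_elliptope M = {Y. is_arg_max (\<lambda>Y. M \<bullet> Y) (\<lambda>Y. Y \<in> elliptope) Y}"

definition fixed_point :: "real^'n^'n \<Rightarrow> bool"
  where "fixed_point X \<longleftrightarrow> X \<in> elliptope \<and> X \<in> argmax_elliptope X"

definition iteration_from :: "real^'n^'n \<Rightarrow> (nat \<Rightarrow> real^'n^'n) \<Rightarrow> bool"
  where "iteration_from X\<^sub>0 S \<longleftrightarrow> S 0 = X\<^sub>0 \<and> (\<forall>i. S (Suc i) \<in> argmax_elliptope (S i))"

definition attractive_fixed_point :: "real^'n^'n \<Rightarrow> bool"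
  where "attractive_fixed_point X \<longleftrightarrow> fixed_point X \<and>
    (\<exists>\<epsilon>>0. \<forall>X\<^sub>0\<in>elliptope. norm (X - X\<^sub>0) < \<epsilon> \<longrightarrow>
      (\<forall>S. iteration_from X\<^sub>0 S \<longrightarrow> S \<longlonglongrightarrow> X))"

end

theory Submission
  imports Defs
begin

text \<open>
  Write \<open>x\<^sub>i\<^sub>j\<close> for the entries of \<open>X\<close>.

  A vertex \<open>X\<close> attracts because its entries are signs. All entries of a matrix in the elliptope lie
  in \<open>[-1, 1]\<close>, so if every entry of \<open>M\<close> is nonzero with the sign of \<open>x\<^sub>i\<^sub>j\<close>, then \<open>X\<close> is the only
  maximizer of \<open>M \<bullet> Y\<close>. This holds for all \<open>M\<close> at distance less than \<open>1\<close> from \<open>X\<close>, so the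
  iteration reaches \<open>X\<close> after one step and stays there (\<open>argmax_near_vertex\<close>).

  Conversely, \<open>norm (S i)\<close> increases along every iteration \<open>S\<close>, by Cauchy-Schwarz. A matrix of larger
  norm than \<open>X\<close> therefore never leads to \<open>X\<close>, and an attractive fixed point \<open>X\<close> is a local maximum
  of the norm (\<open>attractive_imp_local_max_norm\<close>). It remains to increase the norm near every fixed
  point that is not a vertex.

  A fixed point satisfies \<open>X\<^sup>2 = D X\<close> with \<open>D\<close> diagonal (\<open>fixed_point_balanced\<close>). If \<open>X\<close> is
  the Gram matrix of unit vectors \<open>v\<^sub>i\<close>, this says that each \<open>v\<^sub>i\<close> is an eigenvector of
  \<open>\<Sum>\<^sub>j v\<^sub>j v\<^sub>j\<^sup>T\<close> with eigenvalue \<open>d\<^sub>i\<close>. Move \<open>X\<close> to \<open>X + s Y\<close> and rescale the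
  diagonal to \<open>1\<close>. For \<open>Y = X\<^sub>k X\<^sub>l\<^sup>T + X\<^sub>l X\<^sub>k\<^sup>T\<close> with columns \<open>X\<^sub>k\<close>, \<open>X\<^sub>l\<close> of \<open>X\<close>, the first-order
  change of the squared norm vanishes by \<open>X\<^sup>2 = D X\<close>, so at a local maximum the second-order
  term \<open>q\<^sub>k\<^sub>l\<close> is at most \<open>0\<close> for all \<open>k\<close>, \<open>l\<close> (\<open>local_max_second_order\<close>).

  If \<open>d\<^sub>k \<noteq> d\<^sub>l\<close>, then \<open>v\<^sub>k\<close> and \<open>v\<^sub>l\<close> lie in different eigenspaces, \<open>Y\<close> has diagonal \<open>0\<close>, and
  \<open>q\<^sub>k\<^sub>l\<close> is the squared norm of \<open>Y\<close>, which is positive. So \<open>D = \<delta> I\<close>, and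
  \<open>\<Sum>\<^sub>k\<^sub>l q\<^sub>k\<^sub>l = 2 \<delta>\<^sup>2 \<Sum>\<^sub>i\<^sub>j (1 - x\<^sub>i\<^sub>j\<^sup>2) (1 - 2 x\<^sub>i\<^sub>j\<^sup>2)\<close>. The summands equal
  \<open>2 (x\<^sub>i\<^sub>j\<^sup>2 - 1/2)\<^sup>2 + (1/2 - x\<^sub>i\<^sub>j\<^sup>2)\<close>, and \<open>\<Sum>\<^sub>j x\<^sub>i\<^sub>j\<^sup>2 = \<delta>\<close>, so the double sum is positive as soon
  as \<open>\<delta> \<le> n/2\<close>. As \<open>X / \<delta>\<close> is a projection with trace \<open>n / \<delta>\<close>, that inequality says that
  \<open>X\<close> has rank at least two; it follows from \<open>elliptope_Bessel\<close> as soon as some entry of \<open>X\<close> is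
  not \<open>\<plusminus>1\<close> (\<open>local_max_balanced_imp_vertex\<close>).
\<close>

section \<open>Positive semidefinite matrices\<close>

lemma psd_symD: "psd X \<Longrightarrow> X$i$j = X$j$i" for X :: "real^'n^'n"
  unfolding psd_def symmetric_matrix_def transpose_def vec_eq_iff by (metis vec_lambda_beta)

lemma psd_inner_commute:
  fixes X :: "real^'n^'n"
  assumes "psd X"
  shows "x \<bullet> (X *v y) = y \<bullet> (X *v x)"
  using assms by (metis dot_lmul_matrix inner_commute psd_def symmetric_matrix_def
      transpose_matrix_vector)

lemma psd_Cauchy_Schwarz:
  fixes X :: "real^'n^'n"
  assumes "psd X"
  shows "(x \<bullet> (X *v y))\<^sup>2 \<le> (x \<bullet> (X *v x)) * (y \<bullet> (X *v y))"
proof -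
  define a b c where "a = x \<bullet> (X *v x)" and "b = x \<bullet> (X *v y)" and "c = y \<bullet> (X *v y)"
  have nonneg: "0 \<le> s\<^sup>2 * a - 2 * s * t * b + t\<^sup>2 * c" for s t
  proof -
    have "0 \<le> (s *\<^sub>R x - t *\<^sub>R y) \<bullet> (X *v (s *\<^sub>R x - t *\<^sub>R y))"
      using assms by (simp add: psd_def)
    also have "\<dots> = s\<^sup>2 * a - 2 * s * t * b + t\<^sup>2 * c"
      using psd_inner_commute[OF assms, of y x]
      by (simp add: a_def b_def c_def matrix_vector_mult_diff_distrib matrix_vector_mult_scaleR
          inner_diff_left inner_diff_right power2_eq_square algebra_simps)
    finally show ?thesis .
  qed
  have c0: "0 \<le> c" using assms by (simp add: c_def psd_def)
  have "b\<^sup>2 \<le> a * c"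
  proof (cases "c = 0")
    case True
    have "b = 0"
    proof (rule ccontr)
      assume "b \<noteq> 0"
      with nonneg[of 1 "(a + 1) / (2 * b)"] True show False by simp
    qed
    with True show ?thesis by simp
  next
    case False
    have "c\<^sup>2 * a - 2 * c * b * b + b\<^sup>2 * c = c * (a * c - b\<^sup>2)"
      by (simp add: power2_eq_square algebra_simps)
    with nonneg[of c b] have "0 \<le> c * (a * c - b\<^sup>2)" by simp
    with False c0 show ?thesis by (simp add: zero_le_mult_iff)
  qed
  then show ?thesis by (simp add: a_def b_def c_def)
qed

text \<open>
  Cauchy-Schwarz pairs \<open>x\<close> with \<open>X *v x\<close>: a vector on which the form vanishes is orthogonal, with
  respect to the form, to every vector, in particular to \<open>X *v x\<close>.
\<close>
lemma psd_kernel: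
  fixes X :: "real^'n^'n"
  assumes "psd X" "x \<bullet> (X *v x) \<le> 0"
  shows "X *v x = 0"
proof -
  have "x \<bullet> (X *v x) = 0"
    using assms by (simp add: psd_def order_antisym)
  with psd_Cauchy_Schwarz[OF assms(1), of "X *v x" x]
  have "((X *v x) \<bullet> (X *v x))\<^sup>2 \<le> 0" by simp
  then show ?thesis by simp
qed

text \<open>
  Scaled axes turn the entries of \<open>X\<close> and of its diagonal rescalings into values of the form, so that
  facts about forms apply to them.
\<close>
lemma axis_form:
  fixes X :: "real^'n^'n"
  shows "axis i a \<bullet> (X *v axis j b) = a * b * X$i$j"
proof -
  have "X *v axis j b = b *\<^sub>R column j X"
    using matrix_vector_mult_scaleR[of X b "axis j 1"]
    by (simp add: matrix_vector_mult_basis flip: scaleR_conv_of_real)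
       (simp add: axis_def vec_eq_iff matrix_vector_mult_def if_distrib column_def mult.commute cong: if_cong)
  then show ?thesis by (simp add: inner_axis' column_def)
qed

section \<open>The elliptope\<close>

lemma elliptope_psd: "X \<in> elliptope \<Longrightarrow> psd X"
  by (simp add: elliptope_def)

lemma elliptope_diag: "X \<in> elliptope \<Longrightarrow> X$i$i = 1"
  by (simp add: elliptope_def)

lemma elliptope_sym: "X \<in> elliptope \<Longrightarrow> X$i$j = X$j$i"
  by (simp add: elliptope_psd psd_symD)

lemma elliptope_entry_le_1:
  assumes "X \<in> elliptope"
  shows "\<bar>X$i$j\<bar> \<le> 1"
proof -
  have "(X$i$j)\<^sup>2 \<le> 1"
    using psd_Cauchy_Schwarz[OF elliptope_psd[OF assms], of "axis i 1" "axis j 1"]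
    by (simp add: axis_form elliptope_diag[OF assms])
  then show ?thesis by (simp add: abs_square_le_1)
qed

text \<open>
  For unit vectors with Gram matrix \<open>X\<close>, this is Cauchy-Schwarz for the components of \<open>v\<^sub>i\<close> and \<open>v\<^sub>l\<close>
  orthogonal to \<open>v\<^sub>k\<close>; equivalently, \<open>v\<^sub>i\<close> is at least as long as its projection to the plane
  spanned by \<open>v\<^sub>k\<close> and \<open>v\<^sub>l\<close>. The right-hand side vanishes when \<open>x\<^sub>k\<^sub>l = \<plusminus>1\<close> or \<open>x\<^sub>i\<^sub>k = \<plusminus>1\<close>,
  which forces \<open>x\<^sub>i\<^sub>l = x\<^sub>k\<^sub>l x\<^sub>i\<^sub>k\<close>.
\<close>
lemma elliptope_Bessel:
  fixes X :: "real^'n^'n"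
  assumes "X \<in> elliptope"
  shows "(X$i$l - X$k$l * X$i$k)\<^sup>2 \<le> (1 - (X$i$k)\<^sup>2) * (1 - (X$k$l)\<^sup>2)"
proof -
  have residual: "(axis i 1 - axis k (X$i$k)) \<bullet> (X *v (axis j 1 - axis k (X$j$k)))
      = X$i$j - X$i$k * X$j$k" for i j
    using elliptope_sym[OF assms, of k j]
    by (simp add: matrix_vector_mult_diff_distrib inner_diff_left inner_diff_right axis_form
        elliptope_diag[OF assms])
  show ?thesis
    using psd_Cauchy_Schwarz[OF elliptope_psd[OF assms], of "axis i 1 - axis k (X$i$k)"
        "axis l 1 - axis k (X$l$k)"] elliptope_sym[OF assms, of k l]
    by (simp only: residual) (simp add: elliptope_diag[OF assms] power2_eq_square mult.commute)
qed

lemma vertex_if_unit_entries: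
  fixes X :: "real^'n^'n"
  assumes X: "X \<in> elliptope" and unit: "\<And>i j. (X$i$j)\<^sup>2 = 1"
  shows "X \<in> elliptope_vertices"
proof -
  fix k :: 'n
  have prod: "X$i$j = X$k$i * X$k$j" for i j
  proof -
    have "(X$i$j - X$k$j * X$i$k)\<^sup>2 \<le> 0"
      using elliptope_Bessel[OF X, of i j k] by (simp add: unit)
    then have "X$i$j = X$k$j * X$i$k" by simp
    then show ?thesis by (simp only: elliptope_sym[OF X, of i k] mult.commute)
  qed
  have "X = (\<chi> i j. (X$k)$i * (X$k)$j)"
    unfolding vec_eq_iff vec_lambda_beta by (intro allI prod)
  moreover have "X$k$i \<in> {-1, 1}" for i
    using unit[of k i] by (auto simp: power2_eq_1_iff)
  ultimately show ?thesis
    unfolding elliptope_vertices_eq_outer_products by blast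
qed

text \<open>
  The source of competitors of \<open>X\<close>: every family of vectors gives a positive semidefinite matrix
  of pairwise form values, which lies in the elliptope as soon as the vectors have unit length for
  the form.
\<close>
lemma psd_Gram:
  fixes X :: "real^'n^'n" and b :: "'m::finite \<Rightarrow> real^'n"
  assumes "psd X"
  shows "psd (\<chi> i j. b i \<bullet> (X *v b j))"
proof -
  have "x \<bullet> ((\<chi> i j. b i \<bullet> (X *v b j)) *v x)
      = (\<Sum>i\<in>UNIV. x$i *\<^sub>R b i) \<bullet> (X *v (\<Sum>i\<in>UNIV. x$i *\<^sub>R b i))" for x :: "real^'m"
  proof -
    have "X *v (\<Sum>j\<in>UNIV. x$j *\<^sub>R b j) = (\<Sum>j\<in>UNIV. x$j *\<^sub>R (X *v b j))"
      by (simp add: linear_sum[OF matrix_vector_mul_linear] matrix_vector_mult_scaleR o_def)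
    then show ?thesis
      by (simp add: inner_vec_def[of x] matrix_vector_mult_def[of "vec_lambda _"] inner_sum_left inner_sum_right
        sum_distrib_left mult_ac)
         (intro sum.cong refl, simp add: psd_inner_commute[OF assms, of "b _" "b _"])
  qed
  moreover have "transpose (\<chi> i j. b i \<bullet> (X *v b j)) = (\<chi> i j. b i \<bullet> (X *v b j))"
    by (simp add: transpose_def vec_eq_iff psd_inner_commute[OF assms])
  ultimately show ?thesis
    using assms by (simp add: psd_def symmetric_matrix_def)
qed

lemma normalize_in_elliptope:
  fixes Z :: "real^'n^'n"
  assumes "psd Z" and "\<And>i. 0 < Z$i$i"
  shows "(\<chi> i j. Z$i$j / (sqrt (Z$i$i) * sqrt (Z$j$j))) \<in> elliptope"
proof -
  have "psd (\<chi> i j. axis i (1 / sqrt (Z$i$i)) \<bullet> (Z *v axis j (1 / sqrt (Z$j$j))))"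
    by (rule psd_Gram[OF assms(1)])
  with assms(2) show ?thesis
    by (simp add: elliptope_def axis_form less_imp_le less_imp_neq[symmetric])
qed

lemma closed_elliptope: "closed (elliptope :: (real^'n^'n) set)"
proof -
  have "elliptope = (\<Inter>i. \<Inter>j. {X :: real^'n^'n. X$i$j = X$j$i})
      \<inter> (\<Inter>x. {X. 0 \<le> x \<bullet> (X *v x)}) \<inter> (\<Inter>i. {X. X$i$i = 1})"
    by (auto simp: elliptope_def psd_def symmetric_matrix_def transpose_def vec_eq_iff)
  also have "closed \<dots>"
    unfolding inner_vec_def matrix_vector_mult_def
    by (intro closed_Int closed_INT ballI closed_Collect_eq closed_Collect_le continuous_intros)
  finally show ?thesis .
qed

lemma compact_elliptope: "compact (elliptope :: (real^'n^'n) set)"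
proof -
  have "norm X \<le> real (CARD('n)) * CARD('n)" if "X \<in> elliptope" for X :: "real^'n^'n"
  proof -
    have row: "norm (X$i) \<le> CARD('n)" for i
    proof -
      have "norm (X$i) \<le> (\<Sum>j\<in>UNIV. \<bar>X$i$j\<bar>)" by (rule norm_le_l1_cart)
      also have "\<dots> \<le> (\<Sum>j\<in>(UNIV::'n set). 1)"
        by (intro sum_mono elliptope_entry_le_1 that)
      finally show ?thesis by simp
    qed
    have "norm X \<le> (\<Sum>i\<in>UNIV. norm (X$i))"
      unfolding norm_vec_def by (rule L2_set_le_sum) simp
    also have "\<dots> \<le> (\<Sum>i\<in>(UNIV::'n set). real (CARD('n)))" by (intro sum_mono row)
    finally show ?thesis by simp
  qed
  then have "bounded (elliptope :: (real^'n^'n) set)"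
    unfolding bounded_iff by blast
  with closed_elliptope show ?thesis by (simp add: compact_eq_bounded_closed)
qed

section \<open>The iteration and the norm\<close>

lemma mem_argmax_elliptope:
  "Y \<in> argmax_elliptope M \<longleftrightarrow> Y \<in> elliptope \<and> (\<forall>Z\<in>elliptope. M \<bullet> Z \<le> M \<bullet> Y)"
  by (auto simp: argmax_elliptope_def is_arg_max_def not_less)

lemma argmax_elliptope_nonempty: "\<exists>Y. Y \<in> argmax_elliptope M"
  for M :: "real^'n^'n"
proof -
  have "(mat 1 :: real^'n^'n) \<in> elliptope"
    by (auto simp: elliptope_def psd_def symmetric_matrix_def transpose_mat)
       (simp add: mat_def)
  then have "(elliptope :: (real^'n^'n) set) \<noteq> {}" by blast
  moreover have "continuous_on elliptope (\<lambda>Y. M \<bullet> Y)" by (intro continuous_intros)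
  ultimately show ?thesis
    using continuous_attains_sup[OF compact_elliptope] by (fastforce simp: mem_argmax_elliptope)
qed

text \<open>
  Attractiveness speaks about all iterations from a point, so it yields information only once there
  is at least one. Maximizers exist because the elliptope is compact.
\<close>
lemma iteration_exists: "\<exists>S. iteration_from X\<^sub>0 S"
proof -
  define S where "S = rec_nat X\<^sub>0 (\<lambda>_ M. SOME Y. Y \<in> argmax_elliptope M)"
  have "iteration_from X\<^sub>0 S"
    unfolding iteration_from_def S_def by (simp add: someI_ex[OF argmax_elliptope_nonempty])
  then show ?thesis by blast
qed

text \<open>
  The iterate \<open>S i\<close> competes against \<open>S (Suc i)\<close> in the maximization that defines the latter, so
  \<open>S i \<bullet> S i \<le> S i \<bullet> S (Suc i) \<le> norm (S i) * norm (S (Suc i))\<close>.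
\<close>
lemma iteration_norm_incseq:
  assumes "X\<^sub>0 \<in> elliptope" "iteration_from X\<^sub>0 S"
  shows "incseq (\<lambda>i. norm (S i))"
proof (rule incseq_SucI)
  fix i
  have mem: "S i \<in> elliptope" for i
    using assms by (cases i) (auto simp: iteration_from_def mem_argmax_elliptope)
  have "S i \<bullet> S i \<le> S i \<bullet> S (Suc i)"
    using assms(2) mem by (auto simp: iteration_from_def mem_argmax_elliptope)
  also have "\<dots> \<le> norm (S i) * norm (S (Suc i))" by (rule norm_cauchy_schwarz)
  finally have "norm (S i) * norm (S i) \<le> norm (S i) * norm (S (Suc i))"
    by (simp add: dot_square_norm power2_eq_square)
  then show "norm (S i) \<le> norm (S (Suc i))"
    by (cases "S i = 0") auto
qed

text \<open>
  Norms along an iteration from \<open>Y\<close> increase from \<open>norm Y\<close> to their limit, which is \<open>norm X\<close> if the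
  iteration converges to \<open>X\<close>.
\<close>
lemma attractive_imp_local_max_norm:
  assumes "attractive_fixed_point X"
  shows "\<exists>\<epsilon>>0. \<forall>Y\<in>elliptope. norm (X - Y) < \<epsilon> \<longrightarrow> norm Y \<le> norm X"
proof -
  obtain \<epsilon> where "\<epsilon> > 0"
    and conv: "\<And>Y S. \<lbrakk>Y \<in> elliptope; norm (X - Y) < \<epsilon>; iteration_from Y S\<rbrakk> \<Longrightarrow> S \<longlonglongrightarrow> X"
    using assms by (auto simp: attractive_fixed_point_def)
  have "norm Y \<le> norm X" if Y: "Y \<in> elliptope" "norm (X - Y) < \<epsilon>" for Y
  proof -
    obtain S where S: "iteration_from Y S" using iteration_exists by blast
    have "norm (S 0) \<le> norm X"
      by (intro incseq_le iteration_norm_incseq[OF Y(1) S] tendsto_norm conv[OF Y S])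
    with S show ?thesis by (simp add: iteration_from_def)
  qed
  with \<open>\<epsilon> > 0\<close> show ?thesis by blast
qed

section \<open>Optimality conditions\<close>

text \<open>
  Think of unit vectors \<open>v\<^sub>j\<close> with Gram matrix \<open>X\<close>, and replace the single vector \<open>v\<^sub>i\<close>. The objective
  \<open>X \<bullet> Y\<close> is then an affine function of the new vector, with gradient \<open>2 u\<close> for
  \<open>u = \<Sum>\<^sub>j\<^sub>\<noteq>\<^sub>i x\<^sub>i\<^sub>j v\<^sub>j\<close>, and the best unit vector is \<open>u\<close> normalized. As \<open>X\<close> is optimal,
  \<open>u = norm u *\<^sub>R v\<^sub>i\<close>, and taking inner products with the \<open>v\<^sub>j\<close> gives the claim with
  \<open>d = 1 + norm u\<close>. In the proof, the coefficient vector \<open>b\<close> represents \<open>u\<close> and \<open>\<beta>\<close> is its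
  squared length.
\<close>
lemma fixed_point_balanced:
  fixes X :: "real^'n^'n"
  assumes "fixed_point X"
  shows "\<exists>d. \<forall>j. (\<Sum>k\<in>UNIV. X$i$k * X$k$j) = d * X$i$j"
proof -
  have X: "X \<in> elliptope" and mx: "\<And>Y. Y \<in> elliptope \<Longrightarrow> X \<bullet> Y \<le> X \<bullet> X"
    using assms by (auto simp: fixed_point_def mem_argmax_elliptope)
  note psd = elliptope_psd[OF X] and diag = elliptope_diag[OF X] and sym = elliptope_sym[OF X]
  define b :: "real^'n" where "b = X$i - axis i 1"
  define \<beta> where "\<beta> = b \<bullet> (X *v b)"
  have \<beta>0: "0 \<le> \<beta>" using psd by (simp add: \<beta>_def psd_def)
  have bi: "b$i = 0" by (simp add: b_def diag)
  have bj: "b$j = X$i$j" if "j \<noteq> i" for j using that by (simp add: b_def axis_def)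
  have cross: "axis j 1 \<bullet> (X *v b) = (X *v b)$j" for j by (simp add: inner_axis')
  have "sqrt \<beta> \<le> (X *v b)$i" if "\<beta> \<noteq> 0"
  proof -
    from that \<beta>0 have \<beta>: "\<beta> > 0" by simp
    \<comment> \<open>The competitor: \<open>v\<^sub>i\<close> is replaced by the normalization of \<open>u\<close>.\<close>
    define c where "c j = (if j = i then b /\<^sub>R sqrt \<beta> else axis j 1)" for j
    define Y where "Y = (\<chi> j k. c j \<bullet> (X *v c k))"
    have psdY: "psd Y" unfolding Y_def by (rule psd_Gram[OF psd])
    have "Y$j$j = 1" for j
      using \<beta> by (simp add: Y_def c_def axis_form diag matrix_vector_mult_scaleR
          flip: \<beta>_def) (simp add: field_simps)
    with psdY have Y: "Y \<in> elliptope" by (simp add: elliptope_def)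
    have Yji: "Y$j$i = (X *v b)$j / sqrt \<beta>" if "j \<noteq> i" for j
      using that by (simp add: Y_def c_def matrix_vector_mult_scaleR cross divide_inverse mult.commute)
    have Yjk: "Y$j$k = X$j$k" if "j \<noteq> i" "k \<noteq> i" for j k
      using that by (simp add: Y_def c_def axis_form)
    have Ysym: "Y$i$j = Y$j$i" for j by (rule elliptope_sym[OF Y])
    define g where "g j = (X *v b)$j / sqrt \<beta> - X$i$j" for j
    have entry: "X$j$k * (Y$j$k - X$j$k) = (if j = i then b$k * g k else 0) + (if k = i then b$j * g j else 0)"
      for j k
      by (cases "j = i"; cases "k = i")
        (simp_all add: bi bj Yji Yjk Ysym g_def elliptope_diag[OF Y] diag sym[of _ i])
    have "X \<bullet> Y - X \<bullet> X = (\<Sum>j\<in>UNIV. \<Sum>k\<in>UNIV. X$j$k * (Y$j$k - X$j$k))"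
      by (simp add: inner_matrix_eq_sum sum_subtractf right_diff_distrib)
    also have "\<dots> = 2 * (\<Sum>k\<in>UNIV. b$k * g k)"
    proof -
      have "(\<Sum>j\<in>UNIV. \<Sum>k\<in>UNIV. if j = i then b$k * g k else 0) = (\<Sum>k\<in>UNIV. b$k * g k)"
        by (subst sum.swap) simp
      then show ?thesis by (simp add: entry sum.distrib)
    qed
    also have "(\<Sum>k\<in>UNIV. b$k * g k) = \<beta> / sqrt \<beta> - b \<bullet> (X$i)"
      by (simp add: g_def \<beta>_def inner_vec_def right_diff_distrib sum_subtractf sum_divide_distrib)
    also have "\<beta> / sqrt \<beta> = sqrt \<beta>" by (simp add: real_div_sqrt \<beta>0)
    also have "b \<bullet> (X$i) = (X *v b)$i"
      by (simp add: inner_vec_def matrix_vector_mult_def mult.commute)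
    finally show ?thesis using mx[OF Y] by simp
  qed
  moreover have "(X *v b)$i = 0" if "\<beta> = 0"
    using psd_kernel[OF psd, of b] that by (simp add: \<beta>_def)
  ultimately have le: "sqrt \<beta> \<le> (X *v b)$i" by (cases "\<beta> = 0") simp_all
  \<comment> \<open>This is the equality case of Cauchy-Schwarz for \<open>u\<close> and \<open>v\<^sub>i\<close>, so \<open>u - sqrt \<beta> *\<^sub>R v\<^sub>i\<close>,
    with coefficient vector \<open>w\<close>, has length \<open>0\<close>.\<close>
  define w where "w = b - axis i (sqrt \<beta>)"
  have ax: "axis i (sqrt \<beta>) \<bullet> (X *v b) = sqrt \<beta> * (X *v b)$i"
    by (simp add: inner_axis')
  have "w \<bullet> (X *v w) = \<beta> - 2 * (sqrt \<beta> * (X *v b)$i) + sqrt \<beta> * sqrt \<beta>"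
    using psd_inner_commute[OF psd, of b "axis i (sqrt \<beta>)"]
    by (simp add: w_def matrix_vector_mult_diff_distrib inner_diff_left inner_diff_right ax axis_form
        diag flip: \<beta>_def)
  also have "\<dots> = 2 * (sqrt \<beta> * (sqrt \<beta> - (X *v b)$i))"
    using \<beta>0 by (simp add: right_diff_distrib)
  also have "\<dots> \<le> 0" using le \<beta>0 by (simp add: mult_nonneg_nonpos)
  finally have "X *v w = 0" by (rule psd_kernel[OF psd])
  moreover have "w = X$i - axis i (1 + sqrt \<beta>)"
    by (simp add: w_def b_def vec_eq_iff axis_def)
  ultimately have eq: "X *v (X$i) = X *v axis i (1 + sqrt \<beta>)"
    by (simp add: matrix_vector_mult_diff_distrib)
  have "(\<Sum>k\<in>UNIV. X$i$k * X$k$j) = (1 + sqrt \<beta>) * X$i$j" for j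
  proof -
    have "(\<Sum>k\<in>UNIV. X$i$k * X$k$j) = (X *v (X$i))$j"
      by (simp add: matrix_vector_mult_def sym[of j] mult.commute)
    also have "\<dots> = axis j 1 \<bullet> (X *v axis i (1 + sqrt \<beta>))" by (simp add: eq inner_axis')
    finally show ?thesis by (simp add: axis_form sym[of j])
  qed
  then show ?thesis by blast
qed

text \<open>
  The competitors are the matrices \<open>X + s Y\<close> rescaled to diagonal \<open>1\<close>. With \<open>h\<^sub>i = y\<^sub>i\<^sub>i\<close>, their squared
  entries are \<open>(x\<^sub>i\<^sub>j + s y\<^sub>i\<^sub>j)\<^sup>2 / ((1 + s h\<^sub>i) (1 + s h\<^sub>j))\<close>; the hypothesis \<open>first\<close> and the conclusion
  concern the sums of the coefficients of \<open>s\<close> and \<open>s\<^sup>2\<close> in the expansion at \<open>s = 0\<close>.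

  The inequality \<open>z\<^sup>2 / w \<ge> 2 z \<mu> - \<mu>\<^sup>2 w\<close>, valid for all \<open>\<mu>\<close> and all \<open>w > 0\<close>, replaces Taylor
  estimates. Taking for \<open>\<mu>\<close> the first-order expansion of \<open>z / w\<close> makes the right-hand side a
  polynomial in \<open>s\<close> that agrees with the left-hand side up to second order.
\<close>
lemma local_max_second_order:
  fixes X Y :: "real^'n^'n"
  assumes X: "X \<in> elliptope"
    and local_max: "\<epsilon> > 0" "\<And>Z. \<lbrakk>Z \<in> elliptope; norm (X - Z) < \<epsilon>\<rbrakk> \<Longrightarrow> norm Z \<le> norm X"
    and psd: "\<forall>\<^sub>F s in at_right 0. psd (X + s *\<^sub>R Y)"
    and first: "(\<Sum>i\<in>UNIV. \<Sum>j\<in>UNIV. 2 * X$i$j * Y$i$j - (X$i$j)\<^sup>2 * (Y$i$i + Y$j$j)) = 0"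
  shows "(\<Sum>i\<in>UNIV. \<Sum>j\<in>UNIV. (Y$i$j - X$i$j * (Y$i$i + Y$j$j))\<^sup>2 - (X$i$j)\<^sup>2 * (Y$i$i * Y$j$j)) \<le> 0"
    (is "?q \<le> 0")
proof (rule ccontr)
  assume "\<not> ?q \<le> 0"
  then have q: "?q > 0" by simp
  define h where "h i = Y$i$i" for i
  \<comment> \<open>\<open>m i j\<close> is the first-order coefficient of \<open>\<mu>\<close>; \<open>R\<close> and \<open>T\<close> collect the coefficients of
    \<open>s\<^sup>3\<close> and \<open>s\<^sup>4\<close> in the polynomial lower bound.\<close>
  define m where "m i j = Y$i$j - X$i$j * (h i + h j)" for i j
  define R where "R = (\<Sum>i\<in>UNIV. \<Sum>j\<in>UNIV. - (m i j)\<^sup>2 * (h i + h j) - 2 * X$i$j * m i j * (h i * h j))"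
  define T where "T = (\<Sum>i\<in>UNIV. \<Sum>j\<in>UNIV. - (m i j)\<^sup>2 * (h i * h j))"
  define N where "N s = (\<chi> i j. (X + s *\<^sub>R Y)$i$j / (sqrt ((X + s *\<^sub>R Y)$i$i) * sqrt ((X + s *\<^sub>R Y)$j$j)))"
    for s :: real
  have diag: "(X + s *\<^sub>R Y)$i$i = 1 + s * h i" for s i
    by (simp add: h_def elliptope_diag[OF X])
  have "((\<lambda>s. (X + s *\<^sub>R Y)$i$i) \<longlongrightarrow> 1) (at_right 0)" for i
    unfolding diag by (auto intro!: tendsto_eq_intros)
  then have "\<forall>\<^sub>F s in at_right 0. 0 < (X + s *\<^sub>R Y)$i$i" for i
    by (rule order_tendstoD) simp
  then have pos: "\<forall>\<^sub>F s in at_right 0. \<forall>i. 0 < (X + s *\<^sub>R Y)$i$i"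
    by (simp add: eventually_all_finite)
  have "(N \<longlongrightarrow> X) (at_right 0)"
  proof (intro vec_tendstoI)
    fix i j
    show "((\<lambda>s. N s $ i $ j) \<longlongrightarrow> X$i$j) (at_right 0)"
      unfolding N_def vec_lambda_beta diag by (auto intro!: tendsto_eq_intros)
  qed
  then have near: "\<forall>\<^sub>F s in at_right 0. norm (X - N s) < \<epsilon>"
    using local_max(1) by (auto dest: tendstoD simp: dist_norm norm_minus_commute)
  have "((\<lambda>s. ?q + s * R + s\<^sup>2 * T) \<longlongrightarrow> ?q) (at_right 0)"
    by (auto intro!: tendsto_eq_intros)
  then have gain: "\<forall>\<^sub>F s in at_right 0. 0 < ?q + s * R + s\<^sup>2 * T"
    using q by (rule order_tendstoD)
  have "\<forall>\<^sub>F s in at_right (0::real). 0 < s" by (simp add: eventually_at_right_less)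
  with psd pos near gain have "\<forall>\<^sub>F s in at_right (0::real). False"
  proof eventually_elim
    case (elim s)
    have mem: "N s \<in> elliptope"
      unfolding N_def using elim(1,2) by (intro normalize_in_elliptope) auto
    have pos': "0 < 1 + s * h i" for i using elim(2) by (simp only: diag)
    have entry: "(X$i$j)\<^sup>2 + s * (2 * X$i$j * Y$i$j - (X$i$j)\<^sup>2 * (h i + h j))
        + s\<^sup>2 * ((m i j)\<^sup>2 - (X$i$j)\<^sup>2 * (h i * h j))
        + s^3 * (- (m i j)\<^sup>2 * (h i + h j) - 2 * X$i$j * m i j * (h i * h j))
        + s^4 * (- (m i j)\<^sup>2 * (h i * h j)) \<le> N s$i$j * N s$i$j" (is "?l \<le> _") for i j
    proof -
      define z w \<mu> where "z = X$i$j + s * Y$i$j" and "w = (1 + s * h i) * (1 + s * h j)"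
        and "\<mu> = X$i$j + s * m i j"
      have w: "w > 0" unfolding w_def by (intro mult_pos_pos pos')
      have "?l = 2 * z * \<mu> - \<mu>\<^sup>2 * w"
        unfolding z_def w_def \<mu>_def m_def by algebra
      also have "\<dots> = z\<^sup>2 / w - (z - \<mu> * w)\<^sup>2 / w"
        using w by (simp add: field_simps power2_eq_square)
      also have "\<dots> \<le> z\<^sup>2 / w" using w by simp
      also have "\<dots> = N s$i$j * N s$i$j"
        unfolding N_def vec_lambda_beta diag using pos'[of i] pos'[of j]
        by (simp add: z_def w_def power2_eq_square field_simps)
      finally show ?thesis .
    qed
    \<comment> \<open>The term \<open>s * 0\<close> is the vanishing first-order contribution.\<close>
    have "X \<bullet> X + s * 0 + s\<^sup>2 * (?q + s * R + s\<^sup>2 * T) \<le> N s \<bullet> N s"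
    proof -
      have "X \<bullet> X + s * 0 + s\<^sup>2 * (?q + s * R + s\<^sup>2 * T)
        = X \<bullet> X + s * 0 + s\<^sup>2 * ?q + s^3 * R + s^4 * T"
        by algebra
      also have "\<dots> = (\<Sum>i\<in>UNIV. \<Sum>j\<in>UNIV. (X$i$j)\<^sup>2 + s * (2 * X$i$j * Y$i$j - (X$i$j)\<^sup>2 * (h i + h j))
        + s\<^sup>2 * ((m i j)\<^sup>2 - (X$i$j)\<^sup>2 * (h i * h j))
        + s^3 * (- (m i j)\<^sup>2 * (h i + h j) - 2 * X$i$j * m i j * (h i * h j))
        + s^4 * (- (m i j)\<^sup>2 * (h i * h j)))"
        unfolding first[symmetric] R_def T_def inner_matrix_eq_sum power2_eq_square[of "X$_$_"]
          m_def h_def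
        by (simp only: sum.distrib sum_distrib_left)
      also have "\<dots> \<le> N s \<bullet> N s"
        unfolding inner_matrix_eq_sum by (intro sum_mono entry)
      finally show ?thesis .
    qed
    moreover have "0 < s\<^sup>2 * (?q + s * R + s\<^sup>2 * T)" using elim by simp
    ultimately have "norm X < norm (N s)" by (simp add: norm_lt)
    with local_max(2)[OF mem elim(3)] show False by simp
  qed
  then show False by simp
qed

section \<open>Local maxima of the norm are vertices\<close>

text \<open>
  The symmetrized outer product of the columns \<open>k\<close> and \<open>l\<close>. For unit vectors with Gram
  matrix \<open>X\<close>, adding a multiple of it deforms the inner product in the direction
  \<open>v\<^sub>k v\<^sub>l\<^sup>T + v\<^sub>l v\<^sub>k\<^sup>T\<close>. If \<open>\<Sum>\<^sub>j v\<^sub>j v\<^sub>j\<^sup>T\<close> is a multiple of the identity, these directions form a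
  tight frame of the symmetric matrices, so summing a quadratic form over all \<open>k\<close>, \<open>l\<close> gives a
  multiple of its trace.
\<close>
definition column_product :: "real^'n^'n \<Rightarrow> 'n \<Rightarrow> 'n \<Rightarrow> real^'n^'n"
  where "column_product X k l = (\<chi> i j. X$i$k * X$j$l + X$i$l * X$j$k)"

text \<open>
  On a vector \<open>x\<close> the column product has the form value \<open>2 p\<^sub>k p\<^sub>l\<close> with \<open>p = X *v x\<close>, and
  \<open>p\<^sub>k\<^sup>2\<close> is at most the value of \<open>X\<close> by Cauchy-Schwarz, because \<open>X$k$k = 1\<close>.
\<close>
lemma psd_add_column_product:
  fixes X :: "real^'n^'n"
  assumes "X \<in> elliptope" "0 \<le> s" "s \<le> 1/2"
  shows "psd (X + s *\<^sub>R column_product X k l)"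
proof -
  note psd = elliptope_psd[OF assms(1)] and sym = elliptope_sym[OF assms(1)]
  have "0 \<le> x \<bullet> ((X + s *\<^sub>R column_product X k l) *v x)" for x
  proof -
    define Q p where "Q = x \<bullet> (X *v x)" and "p k = (X *v x)$k" for k
    have p: "\<bar>p k\<bar> \<le> sqrt Q" for k
    proof (rule real_le_rsqrt[of "\<bar>p k\<bar>"])
      have "axis k 1 \<bullet> (X *v x) = p k" by (simp add: inner_axis' p_def)
      moreover have "axis k 1 \<bullet> (X *v axis k 1) = 1"
        by (simp only: axis_form elliptope_diag[OF assms(1)])
      ultimately show "\<bar>p k\<bar>\<^sup>2 \<le> Q"
        using psd_Cauchy_Schwarz[OF psd, of "axis k 1" x] by (simp add: Q_def)
    qed
    have Q: "0 \<le> Q" using psd by (simp add: psd_def Q_def)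
    have pk: "p k = (\<Sum>j\<in>UNIV. x$j * X$j$k)" for k
      by (simp add: p_def matrix_vector_mult_def sym[of k] mult.commute)
    have "x \<bullet> (column_product X k l *v x) = (\<Sum>i\<in>UNIV. \<Sum>j\<in>UNIV. (x$i * X$i$k) * (x$j * X$j$l))
         + (\<Sum>i\<in>UNIV. \<Sum>j\<in>UNIV. (x$i * X$i$l) * (x$j * X$j$k))"
      by (simp add: column_product_def matrix_vector_mult_def inner_vec_def sum_distrib_left
          sum.distrib algebra_simps)
    also have "\<dots> = 2 * p k * p l"
      by (simp add: pk flip: sum_product)
    finally have eq: "x \<bullet> (column_product X k l *v x) = 2 * p k * p l" .
    have "\<bar>p k * p l\<bar> \<le> sqrt Q * sqrt Q"
      unfolding abs_mult by (intro mult_mono p) (auto simp: Q)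
    then have "\<bar>p k * p l\<bar> \<le> Q" using Q by simp
    moreover have "\<bar>(2 * s) * (p k * p l)\<bar> \<le> 1 * \<bar>p k * p l\<bar>"
      unfolding abs_mult[of "2 * s"] using assms by (intro mult_right_mono) auto
    ultimately have "0 \<le> Q + (2 * s) * (p k * p l)" by linarith
    then show ?thesis
      by (simp add: matrix_vector_mult_add_rdistrib inner_add_right eq Q_def mult_ac
          flip: scaleR_matrix_vector_assoc)
  qed
  moreover have "transpose (X + s *\<^sub>R column_product X k l) = X + s *\<^sub>R column_product X k l"
    by (simp add: transpose_def vec_eq_iff column_product_def sym)
  ultimately show ?thesis by (simp add: psd_def symmetric_matrix_def)
qed

text \<open>
  Second-order optimality in the directions \<open>column_product X k l\<close>: a single pair refutes
  \<open>d k \<noteq> d l\<close>, and the sum over all pairs refutes any entry other than \<open>\<plusminus>1\<close>. Summing is needed since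
  the second-order term need not be positive for an individual pair: if all the underlying unit
  vectors agree up to sign with vectors of an orthonormal basis, then the pairs with \<open>k = l\<close> give
  \<open>X\<close> again after rescaling.
\<close>
lemma local_max_balanced_imp_vertex:
  fixes X :: "real^'n^'n"
  assumes X: "X \<in> elliptope"
    and local_max: "\<epsilon> > 0" "\<And>Z. \<lbrakk>Z \<in> elliptope; norm (X - Z) < \<epsilon>\<rbrakk> \<Longrightarrow> norm Z \<le> norm X"
    and balanced: "\<And>i j. (\<Sum>k\<in>UNIV. X$i$k * X$k$j) = d i * X$i$j"
  shows "X \<in> elliptope_vertices"
proof -
  note sym = elliptope_sym[OF X] and diag = elliptope_diag[OF X]
  have row: "(\<Sum>k\<in>UNIV. X$i$k * X$j$k) = d i * X$i$j" for i j
    using balanced[of i j] by (simp add: sym[of _ j])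
  have sq: "(\<Sum>k\<in>UNIV. (X$i$k)\<^sup>2) = d i" for i
    using row[of i i] by (simp add: diag power2_eq_square)
  have d_sym: "d i * X$i$j = d j * X$i$j" for i j
    using row[of i j] row[of j i] by (simp add: mult.commute sym[of j i])
  have d_pos: "d i > 0" for i
  proof -
    have "(X$i$i)\<^sup>2 \<le> (\<Sum>k\<in>UNIV. (X$i$k)\<^sup>2)" by (rule member_le_sum) auto
    then show ?thesis by (simp add: sq diag)
  qed
  define y where "y k l = column_product X k l" for k l
  have y: "y k l$i$j = X$i$k * X$j$l + X$i$l * X$j$k" for k l i j
    by (simp add: y_def column_product_def)
  define q where "q k l i j = (y k l$i$j - X$i$j * (y k l$i$i + y k l$j$j))\<^sup>2
    - (X$i$j)\<^sup>2 * (y k l$i$i * y k l$j$j)" for k l i j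
  have q: "(\<Sum>i\<in>UNIV. \<Sum>j\<in>UNIV. q k l i j) \<le> 0" for k l
    unfolding q_def
  proof (rule local_max_second_order[OF X local_max])
    have "\<forall>\<^sub>F s in at_right (0::real). s \<in> {0<..<1/2}"
      by (rule eventually_at_right_real) simp
    then show "\<forall>\<^sub>F s in at_right 0. psd (X + s *\<^sub>R y k l)"
      by eventually_elim (simp add: y_def psd_add_column_product[OF X])
    have "(\<Sum>j\<in>UNIV. X$i$j * y k l$i$j) = d i * y k l$i$i" for i
    proof -
      have "(\<Sum>j\<in>UNIV. X$i$j * y k l$i$j)
          = X$i$k * (\<Sum>j\<in>UNIV. X$i$j * X$j$l) + X$i$l * (\<Sum>j\<in>UNIV. X$i$j * X$j$k)"
        by (simp add: y sum.distrib sum_distrib_left algebra_simps)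
      then show ?thesis by (simp only: balanced y) (simp add: algebra_simps)
    qed
    then have A: "(\<Sum>i\<in>UNIV. \<Sum>j\<in>UNIV. X$i$j * y k l$i$j) = (\<Sum>i\<in>UNIV. d i * y k l$i$i)"
      by simp
    have B: "(\<Sum>i\<in>UNIV. \<Sum>j\<in>UNIV. (X$i$j)\<^sup>2 * y k l$i$i) = (\<Sum>i\<in>UNIV. d i * y k l$i$i)"
      by (simp add: sq flip: sum_distrib_right)
    then have C: "(\<Sum>i\<in>UNIV. \<Sum>j\<in>UNIV. (X$i$j)\<^sup>2 * y k l$j$j) = (\<Sum>i\<in>UNIV. d i * y k l$i$i)"
      by (subst sum.swap) (simp add: sym)
    have "(\<Sum>i\<in>UNIV. \<Sum>j\<in>UNIV. 2 * X$i$j * y k l$i$j - (X$i$j)\<^sup>2 * (y k l$i$i + y k l$j$j))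
      = 2 * (\<Sum>i\<in>UNIV. \<Sum>j\<in>UNIV. X$i$j * y k l$i$j)
        - ((\<Sum>i\<in>UNIV. \<Sum>j\<in>UNIV. (X$i$j)\<^sup>2 * y k l$i$i) + (\<Sum>i\<in>UNIV. \<Sum>j\<in>UNIV. (X$i$j)\<^sup>2 * y k l$j$j))"
      by (simp only: sum_subtractf sum.distrib distrib_left sum_distrib_left mult.assoc)
    then show "(\<Sum>i\<in>UNIV. \<Sum>j\<in>UNIV. 2 * X$i$j * y k l$i$j - (X$i$j)\<^sup>2 * (y k l$i$i + y k l$j$j)) = 0"
      by (simp add: A B C)
  qed
  have d_const: "d k = d l" for k l
  proof (rule ccontr)
    assume ne: "d k \<noteq> d l"
    \<comment> \<open>Entries vanish between indices with different values of \<open>d\<close>, and \<open>d i\<close> cannot equal both.\<close>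
    have "X$i$k * X$i$l = 0" for i
      using d_sym[of i k] d_sym[of i l] ne by auto
    then have "y k l$i$i = 0" for i by (simp add: y mult.commute)
    then have q_sq: "q k l i j = (y k l$i$j)\<^sup>2" for i j by (simp add: q_def)
    have "y k l$k$l = 1 + (X$k$l)\<^sup>2"
      by (simp add: y diag sym[of l k] power2_eq_square)
    then have "0 < y k l$k$l" by (simp add: add_pos_nonneg)
    then have "0 < q k l k l" by (simp add: q_sq)
    also have "\<dots> \<le> (\<Sum>j\<in>UNIV. q k l k j)" by (rule member_le_sum) (auto simp: q_sq)
    also have "\<dots> \<le> (\<Sum>i\<in>UNIV. \<Sum>j\<in>UNIV. q k l i j)"
      by (rule member_le_sum) (auto simp: q_sq intro: sum_nonneg)
    finally show False using q[of k l] by simp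
  qed
  define \<delta> where "\<delta> = d undefined"
  have d: "d i = \<delta>" for i unfolding \<delta>_def by (rule d_const)
  have \<delta>: "\<delta> > 0" using d_pos by (simp add: \<delta>_def)
  have average: "(\<Sum>k\<in>UNIV. \<Sum>l\<in>UNIV. q k l i j)
      = 2 * \<delta>\<^sup>2 * (2 * ((X$i$j)\<^sup>2 - 1/2)\<^sup>2 + (1/2 - (X$i$j)\<^sup>2))" for i j
  proof -
    define a b c where "a k = (X$i$k)\<^sup>2" and "b k = (X$j$k)\<^sup>2" and "c k = X$i$k * X$j$k" for k
    define x where "x = X$i$j"
    have sums: "sum a UNIV = \<delta>" "sum b UNIV = \<delta>" "sum c UNIV = \<delta> * x"
      by (simp_all add: a_def b_def c_def sq row d x_def)
    \<comment> \<open>Every monomial splits into a factor depending on \<open>k\<close> and one depending on \<open>l\<close>, so all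
      double sums are products of the three sums above.\<close>
    have "q k l i j = a k * b l + b k * a l + 2 * (c k * c l)
        - 4 * x * (a k * c l + c k * a l + b k * c l + c k * b l)
        + 4 * x\<^sup>2 * (a k * a l + b k * b l + c k * c l)" for k l
      unfolding q_def y a_def b_def c_def x_def[symmetric] by algebra
    then have "(\<Sum>k\<in>UNIV. \<Sum>l\<in>UNIV. q k l i j)
      = (\<Sum>k\<in>UNIV. \<Sum>l\<in>UNIV. a k * b l) + (\<Sum>k\<in>UNIV. \<Sum>l\<in>UNIV. b k * a l) + 2 * (\<Sum>k\<in>UNIV. \<Sum>l\<in>UNIV. c k * c l)
        - 4 * x * ((\<Sum>k\<in>UNIV. \<Sum>l\<in>UNIV. a k * c l) + (\<Sum>k\<in>UNIV. \<Sum>l\<in>UNIV. c k * a l)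
           + (\<Sum>k\<in>UNIV. \<Sum>l\<in>UNIV. b k * c l) + (\<Sum>k\<in>UNIV. \<Sum>l\<in>UNIV. c k * b l))
        + 4 * x\<^sup>2 * ((\<Sum>k\<in>UNIV. \<Sum>l\<in>UNIV. a k * a l) + (\<Sum>k\<in>UNIV. \<Sum>l\<in>UNIV. b k * b l)
           + (\<Sum>k\<in>UNIV. \<Sum>l\<in>UNIV. c k * c l))"
      by (simp only: sum.distrib sum_subtractf sum_distrib_left[symmetric])
    then show ?thesis
      unfolding sum_product[symmetric] sums x_def[symmetric]
      by (simp add: power2_eq_square algebra_simps)
  qed
  have "(X$k$l)\<^sup>2 = 1" for k l
  proof (rule ccontr)
    assume "(X$k$l)\<^sup>2 \<noteq> 1"
    moreover have "(X$k$l)\<^sup>2 \<le> 1" using elliptope_entry_le_1[OF X] by (simp add: abs_square_le_1)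
    ultimately have lt: "0 < 1 - (X$k$l)\<^sup>2" by simp
    \<comment> \<open>Bessel's inequality summed over \<open>i\<close> gives \<open>\<delta> \<le> n - \<delta>\<close>.\<close>
    have "\<delta> * (1 - (X$k$l)\<^sup>2) = (\<Sum>i\<in>UNIV. (X$i$l - X$k$l * X$i$k)\<^sup>2)"
    proof -
      have "(X$i$l - X$k$l * X$i$k)\<^sup>2
          = (X$l$i)\<^sup>2 - 2 * X$k$l * (X$k$i * X$l$i) + (X$k$l)\<^sup>2 * (X$k$i)\<^sup>2" for i
        unfolding sym[of i l] sym[of i k] by algebra
      then have "(\<Sum>i\<in>UNIV. (X$i$l - X$k$l * X$i$k)\<^sup>2)
          = (\<Sum>i\<in>UNIV. (X$l$i)\<^sup>2 - 2 * X$k$l * (X$k$i * X$l$i) + (X$k$l)\<^sup>2 * (X$k$i)\<^sup>2)"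
        by (intro sum.cong refl)
      also have "\<dots> = \<delta> - 2 * X$k$l * (\<delta> * X$k$l) + (X$k$l)\<^sup>2 * \<delta>"
        by (simp only: sum.distrib sum_subtractf sum_distrib_left[symmetric] sq row d)
      finally show ?thesis by (simp add: power2_eq_square algebra_simps)
    qed
    also have "\<dots> \<le> (\<Sum>i\<in>UNIV. (1 - (X$k$i)\<^sup>2) * (1 - (X$k$l)\<^sup>2))"
    proof (rule sum_mono)
      fix i
      show "(X$i$l - X$k$l * X$i$k)\<^sup>2 \<le> (1 - (X$k$i)\<^sup>2) * (1 - (X$k$l)\<^sup>2)"
        using elliptope_Bessel[OF X, of i l k] by (simp only: sym[of i k])
    qed
    also have "\<dots> = (CARD('n) - \<delta>) * (1 - (X$k$l)\<^sup>2)"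
      by (simp add: sum_subtractf sq d flip: sum_distrib_right)
    finally have half: "\<delta> \<le> CARD('n) / 2" using lt by simp
    have row_pos: "0 < (\<Sum>j\<in>UNIV. 2 * ((X$i$j)\<^sup>2 - 1/2)\<^sup>2 + (1/2 - (X$i$j)\<^sup>2))" for i
    proof -
      \<comment> \<open>The diagonal entry makes the sum strictly positive.\<close>
      have "((X$i$i)\<^sup>2 - 1/2)\<^sup>2 \<le> (\<Sum>j\<in>UNIV. ((X$i$j)\<^sup>2 - 1/2)\<^sup>2)" by (rule member_le_sum) auto
      moreover have "(\<Sum>j\<in>UNIV. 1/2 - (X$i$j)\<^sup>2) = CARD('n) / 2 - \<delta>"
        by (simp add: sum_subtractf sq d)
      ultimately show ?thesis
        using half by (simp add: sum.distrib diag power2_eq_square flip: sum_distrib_left)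
    qed
    have "0 < 2 * \<delta>\<^sup>2 * (\<Sum>i\<in>UNIV. \<Sum>j\<in>UNIV. 2 * ((X$i$j)\<^sup>2 - 1/2)\<^sup>2 + (1/2 - (X$i$j)\<^sup>2))"
      using \<delta> by (intro mult_pos_pos sum_pos row_pos) auto
    also have "\<dots> = (\<Sum>i\<in>UNIV. \<Sum>j\<in>UNIV. \<Sum>k\<in>UNIV. \<Sum>l\<in>UNIV. q k l i j)"
      by (simp only: average sum_distrib_left)
    also have "\<dots> = (\<Sum>i\<in>UNIV. \<Sum>k\<in>UNIV. \<Sum>j\<in>UNIV. \<Sum>l\<in>UNIV. q k l i j)"
      by (intro sum.cong refl sum.swap)
    also have "\<dots> = (\<Sum>k\<in>UNIV. \<Sum>i\<in>UNIV. \<Sum>l\<in>UNIV. \<Sum>j\<in>UNIV. q k l i j)"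
      by (subst sum.swap) (intro sum.cong refl sum.swap)
    also have "\<dots> = (\<Sum>k\<in>UNIV. \<Sum>l\<in>UNIV. \<Sum>i\<in>UNIV. \<Sum>j\<in>UNIV. q k l i j)"
      by (intro sum.cong refl sum.swap)
    also have "\<dots> \<le> 0" by (intro sum_nonpos q)
    finally show False by simp
  qed
  then show ?thesis by (rule vertex_if_unit_entries[OF X])
qed

section \<open>Vertices are attractive\<close>

text \<open>
  All entries of \<open>M\<close> are nonzero with the signs of \<open>X\<close>, so \<open>M \<bullet> Y\<close> is the sum of the
  \<open>\<bar>M$i$j\<bar>\<close> weighted by \<open>X$i$j * Y$i$j \<le> 1\<close>, and the maximum requires equality everywhere.
\<close>
lemma argmax_near_vertex:
  assumes X: "X \<in> elliptope_vertices" and near: "norm (X - M) < 1" and Z: "Z \<in> argmax_elliptope M"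
  shows "Z = X"
proof -
  have Xe: "X \<in> elliptope" and unit: "X$i$j \<in> {-1, 1}" for i j
    using X by (auto simp: elliptope_vertices_def)
  have sign: "0 < M$i$j * X$i$j" for i j
  proof -
    have "\<bar>X$i$j - M$i$j\<bar> \<le> norm ((X - M)$i)"
      using component_le_norm_cart[of "(X - M)$i" j] by simp
    also have "\<dots> \<le> norm (X - M)" by (rule Finite_Cartesian_Product.norm_nth_le)
    finally show ?thesis using near unit[of i j] by auto
  qed
  have Ze: "Z \<in> elliptope" and le: "M \<bullet> X \<le> M \<bullet> Z"
    using Z Xe by (auto simp: mem_argmax_elliptope)
  have nonneg: "0 \<le> M$i$j * (X$i$j - Z$i$j)" for i j
    using sign[of i j] unit[of i j] elliptope_entry_le_1[OF Ze, of i j]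
    by (auto simp: zero_le_mult_iff mult_le_0_iff)
  have "(\<Sum>i\<in>UNIV. \<Sum>j\<in>UNIV. M$i$j * (X$i$j - Z$i$j)) \<le> 0"
    using le by (simp add: inner_matrix_eq_sum right_diff_distrib sum_subtractf)
  then have "(\<Sum>i\<in>UNIV. \<Sum>j\<in>UNIV. M$i$j * (X$i$j - Z$i$j)) = 0"
    by (intro antisym sum_nonneg nonneg)
  then have "M$i$j * (X$i$j - Z$i$j) = 0" for i j
    by (simp add: sum_nonneg_eq_0_iff sum_nonneg nonneg)
  with sign have "X$i$j = Z$i$j" for i j
    by (metis less_irrefl mult_eq_0_iff right_minus_eq)
  then show ?thesis by (simp add: vec_eq_iff)
qed

lemma vertex_imp_attractive:
  assumes X: "X \<in> elliptope_vertices"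
  shows "attractive_fixed_point X"
proof -
  have Xe: "X \<in> elliptope" using X by (simp add: elliptope_vertices_def)
  obtain Z where Z: "Z \<in> argmax_elliptope X" using argmax_elliptope_nonempty by blast
  have "Z = X" by (rule argmax_near_vertex[OF X _ Z]) simp
  with Z have "fixed_point X" by (simp add: fixed_point_def Xe)
  moreover have "S \<longlonglongrightarrow> X" if "norm (X - X\<^sub>0) < 1" "iteration_from X\<^sub>0 S" for X\<^sub>0 S
  proof -
    have step: "S (Suc i) \<in> argmax_elliptope (S i)" for i
      using that(2) by (simp add: iteration_from_def)
    have "S (Suc i) = X" for i
    proof (induction i)
      case 0
      show ?case
        by (rule argmax_near_vertex[OF X _ step]) (use that in \<open>simp add: iteration_from_def\<close>)
    next
      case (Suc i)
      show ?case
        by (rule argmax_near_vertex[OF X _ step]) (simp add: Suc)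
    qed
    then have "(\<lambda>i. S (Suc i)) \<longlonglongrightarrow> X" by simp
    then show ?thesis by (rule LIMSEQ_imp_Suc)
  qed
  ultimately show ?thesis
    unfolding attractive_fixed_point_def
    by (intro conjI exI[of _ "1::real"] zero_less_one ballI impI allI)
qed

section \<open>Attractive fixed points are exactly the vertices\<close>

theorem theorem20:
  fixes X :: "real^'n^'n"
  assumes "X \<in> elliptope"
  shows "attractive_fixed_point X \<longleftrightarrow> X \<in> elliptope_vertices"
proof
  assume attractive: "attractive_fixed_point X"
  then have "fixed_point X" by (simp add: attractive_fixed_point_def)
  then have "\<forall>i. \<exists>d. \<forall>j. (\<Sum>k\<in>UNIV. X$i$k * X$k$j) = d * X$i$j"
    by (intro allI fixed_point_balanced)
  then obtain d where "\<And>i j. (\<Sum>k\<in>UNIV. X$i$k * X$k$j) = d i * X$i$j"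
    by metis
  moreover obtain \<epsilon> where "\<epsilon> > 0" "\<And>Z. \<lbrakk>Z \<in> elliptope; norm (X - Z) < \<epsilon>\<rbrakk> \<Longrightarrow> norm Z \<le> norm X"
    using attractive_imp_local_max_norm[OF attractive] by blast
  ultimately show "X \<in> elliptope_vertices"
    by (intro local_max_balanced_imp_vertex[OF assms])
next
  assume "X \<in> elliptope_vertices"
  then show "attractive_fixed_point X" by (rule vertex_imp_attractive)
qed

end
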